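(* For any finite group $G$, the independence number $\alpha(\mathcal{P}_e(G))$ equals the number of maximal cyclic subgroups of $G$. Furthermore, if $G$ is nilpotent and the (distinct) prime factors of $|G|$ are $p_1, p_2, \dots, p_r$, then $$\alpha(\mathcal{P}_e(G)) = m_1 m_2 \cdots m_r,$$ where $m_i$ is the number of maximal cyclic subgroups of a Sylow $p_i$-subgroup of $G$.
   Context: The enhanced power graph $\mathcal{P}_e(G)$ of a group $G$ is the simple undirected graph with vertex set $G$ in which two distinct vertices are adjacent if and only if they belong to a common cyclic subgroup of $G$. A maximal cyclic subgroup of a group is a cyclic subgroup not properly contained in any other cyclic subgroup. The independence number $\alpha(\Gamma)$ of a graph $\Gamma$ is the largest cardinality of a set of pairwise non-adjacent vertices. *)

theory Defs
  imports "HOL-Algebra.Algebra" "Graph_Theory.Pair_Digraph"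
begin

section \<open>Maximal cyclic subgroups\<close>

definition cyclic_subgroup :: "('a, 'b) monoid_scheme \<Rightarrow> 'a set \<Rightarrow> bool" where
  "cyclic_subgroup G C \<longleftrightarrow> subgroup C G \<and> cyclic_group (G\<lparr>carrier := C\<rparr>)"

definition maximal_cyclic_subgroup :: "('a, 'b) monoid_scheme \<Rightarrow> 'a set \<Rightarrow> bool" where
  "maximal_cyclic_subgroup G C \<longleftrightarrow>
     cyclic_subgroup G C \<and> \<not> (\<exists>D. cyclic_subgroup G D \<and> C \<subset> D)"

lemma (in group) cyclic_subgroup_iff_generate:
  "cyclic_subgroup G C \<longleftrightarrow> (\<exists>x\<in>carrier G. C = generate G {x})"
proof
  assume "cyclic_subgroup G C"
  then have C: "subgroup C G" and "cyclic_group (G\<lparr>carrier := C\<rparr>)"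
    by (auto simp: cyclic_subgroup_def)
  then obtain x where x: "x \<in> C"
    and eq: "subgroup_generated (G\<lparr>carrier := C\<rparr>) {x} = G\<lparr>carrier := C\<rparr>"
    by (auto simp: cyclic_group_def)
  have "carrier (subgroup_generated (G\<lparr>carrier := C\<rparr>) {x}) = C"
    using eq by simp
  then have "generate (G\<lparr>carrier := C\<rparr>) {x} = C"
    using x by (simp add: carrier_subgroup_generated)
  then show "\<exists>x\<in>carrier G. C = generate G {x}"
    using generate_consistent[of "{x}" C] x C subgroup.subset[OF C] by auto
next
  assume "\<exists>x\<in>carrier G. C = generate G {x}"
  then obtain x where x: "x \<in> carrier G" and C: "C = generate G {x}"
    by blast
  have sub: "subgroup C G"
    using generate_is_subgroup[of "{x}"] x C by simp
  have xC: "x \<in> C"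
    using C by (simp add: generate.incl)
  have "generate (G\<lparr>carrier := C\<rparr>) {x} = C"
    using generate_consistent[of "{x}" C] xC sub C by simp
  then have "subgroup_generated (G\<lparr>carrier := C\<rparr>) {x} = G\<lparr>carrier := C\<rparr>"
    using xC by (simp add: subgroup_generated_def)
  then show "cyclic_subgroup G C"
    using sub xC by (auto simp: cyclic_subgroup_def cyclic_group_def)
qed


section \<open>Enhanced power graph and independence number\<close>

text \<open>An undirected graph is represented, as usual in \<^theory>\<open>Graph_Theory.Pair_Digraph\<close>, by
  its symmetric set of arcs.\<close>

definition enhanced_power_graph :: "('a, 'b) monoid_scheme \<Rightarrow> 'a pair_pre_digraph" where
  "enhanced_power_graph G =
     \<lparr> pverts = carrier G,
       parcs = {(x, y). x \<in> carrier G \<and> y \<in> carrier G \<and> x \<noteq> y \<and>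
                        (\<exists>C. cyclic_subgroup G C \<and> x \<in> C \<and> y \<in> C)} \<rparr>"

lemma pair_graph_enhanced_power_graph:
  assumes "finite (carrier G)"
  shows "pair_graph (enhanced_power_graph G)"
proof
  have "parcs (enhanced_power_graph G) \<subseteq> carrier G \<times> carrier G"
    by (auto simp: enhanced_power_graph_def)
  then show "finite (parcs (enhanced_power_graph G))"
    using assms finite_subset by blast
next
  show "symmetric (with_proj (enhanced_power_graph G))"
    by (auto simp: enhanced_power_graph_def symmetric_def sym_def)
qed (use assms in \<open>auto simp: enhanced_power_graph_def\<close>)

definition independent_set :: "('a, 'b) pre_digraph \<Rightarrow> 'a set \<Rightarrow> bool" where
  "independent_set \<Gamma> S \<longleftrightarrow> S \<subseteq> verts \<Gamma> \<and> pairwise (\<lambda>u v. \<not> u \<rightarrow>\<^bsub>\<Gamma>\<^esub> v) S"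

text \<open>Meaningful only if \<open>verts \<Gamma>\<close> is finite.\<close>

definition independence_number :: "('a, 'b) pre_digraph \<Rightarrow> nat" where
  "independence_number \<Gamma> = Max (card ` {S. independent_set \<Gamma> S})"


section \<open>Nilpotent groups and Sylow subgroups\<close>

text \<open>The indexing starts at 0, so \<open>lower_central_series G n\<close> is what is
  often written \<open>\<gamma>\<close> with index \<open>n + 1\<close>.\<close>

primrec lower_central_series :: "('a, 'b) monoid_scheme \<Rightarrow> nat \<Rightarrow> 'a set" where
  "lower_central_series G 0 = carrier G"
| "lower_central_series G (Suc n) =
     generate G {h \<otimes>\<^bsub>G\<^esub> g \<otimes>\<^bsub>G\<^esub> inv\<^bsub>G\<^esub> h \<otimes>\<^bsub>G\<^esub> inv\<^bsub>G\<^esub> g | h g.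
                   h \<in> lower_central_series G n \<and> g \<in> carrier G}"

definition nilpotent_group :: "('a, 'b) monoid_scheme \<Rightarrow> bool" where
  "nilpotent_group G \<longleftrightarrow> group G \<and> (\<exists>n. lower_central_series G n = {\<one>\<^bsub>G\<^esub>})"

definition sylow_subgroup :: "('a, 'b) monoid_scheme \<Rightarrow> nat \<Rightarrow> 'a set \<Rightarrow> bool" where
  "sylow_subgroup G p P \<longleftrightarrow>
     Factorial_Ring.prime p \<and> subgroup P G \<and> card P = p ^ multiplicity p (order G)"

lemma sylow_subgroup_exists:
  assumes "group G" "finite (carrier G)" "Factorial_Ring.prime p"
  shows "\<exists>P. sylow_subgroup G p P"
proof -
  obtain m where "order G = p ^ multiplicity p (order G) * m"
    using multiplicity_dvd[of p "order G"] by (auto simp: dvd_def)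
  from sylow_thm[OF assms(3,1) this assms(2)] show ?thesis
    using assms(3) by (auto simp: sylow_subgroup_def)
qed

end

theory Submission
  imports Defs
begin

text \<open>
  An independent set contains at most one element of each maximal cyclic subgroup, and choosing a
  generator of each of these subgroups attains the bound.

  In a nilpotent group, elements \<open>x\<close>, \<open>y\<close> of coprime orders commute: if their commutator \<open>c\<close> lies in a
  term of the lower central series, then modulo the next term \<open>c\<close> is central, hence killed by the
  orders of both \<open>x\<close> and \<open>y\<close>, so \<open>c\<close> lies in the next term as well. Thus the normalizer of a Sylow
  subgroup contains the other Sylow subgroups and is the whole group. It follows that a
  subgroup is determined by its intersections with the Sylow subgroups \<open>P p\<close>, and that cyclic subgroups
  of the \<open>P p\<close> lie together in one cyclic subgroup, generated by the product of their generators.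
  Therefore \<open>C\<close> \<open>\<mapsto>\<close> \<open>(C \<inter> P p)\<^sub>p\<close> is a bijection between the maximal cyclic subgroups of the group and
  the families of maximal cyclic subgroups of the \<open>P p\<close>.
\<close>

section \<open>Commutators of elements of coprime orders\<close>

lemma (in group) mult_inv_cancel:
  assumes "x \<in> carrier G" "y \<in> carrier G"
  shows "inv x \<otimes> (x \<otimes> y) = y" "x \<otimes> (inv x \<otimes> y) = y"
  using assms by (simp_all flip: m_assoc)

lemma (in group) conj_nat_pow:
  assumes "x \<in> carrier G" "y \<in> carrier G"
  shows "(x \<otimes> y \<otimes> inv x) [^] (n::nat) = x \<otimes> y [^] n \<otimes> inv x"
proof (induction n)
  case 0
  then show ?case using assms by simp
next
  case (Suc n)
  have "(x \<otimes> y \<otimes> inv x) [^] Suc n = (x \<otimes> y [^] n \<otimes> inv x) \<otimes> (x \<otimes> y \<otimes> inv x)"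
    using Suc by simp
  also have "\<dots> = x \<otimes> y [^] Suc n \<otimes> inv x"
    using assms by (simp add: m_assoc mult_inv_cancel)
  finally show ?case .
qed

text \<open>As \<open>c\<close> commutes with \<open>y\<close>, powers of
  \<open>c \<otimes> y\<close> split; but \<open>c \<otimes> y\<close> is a conjugate of
  \<open>y\<close>, so \<open>c [^] n\<close> is trivial. Likewise \<open>inv c \<otimes> x\<close>
  is a conjugate of \<open>x\<close>, which kills \<open>c [^] m\<close>. The exponents
  \<open>m\<close> and \<open>n\<close> need not be the exact orders, since orders may shrink in the
  quotients where this is applied.\<close>

lemma (in group) coprime_commutator_eq_one:
  assumes x: "x \<in> carrier G" and y: "y \<in> carrier G"
    and xm: "x [^] (m::nat) = \<one>" and yn: "y [^] (n::nat) = \<one>" and "coprime m n"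
    and c: "c = x \<otimes> y \<otimes> inv x \<otimes> inv y"
    and cx: "c \<otimes> x = x \<otimes> c" and cy: "c \<otimes> y = y \<otimes> c"
  shows "c = \<one>"
proof -
  have cc: "c \<in> carrier G"
    using c x y by simp
  have "c [^] n \<otimes> y [^] n = (c \<otimes> y) [^] n"
    using cc y cy by (metis pow_mult_distrib)
  also have "c \<otimes> y = x \<otimes> y \<otimes> inv x"
    using c x y by (simp add: m_assoc)
  also have "(x \<otimes> y \<otimes> inv x) [^] n = \<one>"
    using conj_nat_pow[OF x y] yn x by simp
  finally have 1: "c [^] n = \<one>"
    using yn cc by simp
  have "inv c \<otimes> x = x \<otimes> inv c"
    using cx cc x by (metis inv_closed inv_solve_left inv_solve_right m_assoc m_closed)
  then have "(inv c) [^] m \<otimes> x [^] m = (inv c \<otimes> x) [^] m"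
    using cc x by (metis pow_mult_distrib inv_closed)
  also have "inv c \<otimes> x = y \<otimes> x \<otimes> inv y"
    using c x y by (simp add: m_assoc inv_mult_group)
  also have "(y \<otimes> x \<otimes> inv y) [^] m = \<one>"
    using conj_nat_pow[OF y x] xm y by simp
  finally have 2: "c [^] m = \<one>"
    using xm cc by (simp add: nat_pow_inv)
  have "ord c dvd m" "ord c dvd n"
    using 1 2 cc by (simp_all add: pow_eq_id)
  then have "ord c = 1"
    using \<open>coprime m n\<close> by (meson coprime_common_divisor_nat nat_dvd_1_iff_1 gcd_greatest coprime_def is_unit_gcd)
  then show ?thesis
    using cc ord_eq_1 by simp
qed

text \<open>A conjugate of a commutator is the commutator of the conjugates, and by induction the
  first entry stays in the previous term. So the generating set is stable under conjugation.
  Normality is what allows passing to the quotient by a term.\<close>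

lemma (in group) lower_central_series_normal: "lower_central_series G n \<lhd> G"
proof (induction n)
  case 0
  then show ?case by (simp add: normal_self)
next
  case (Suc n)
  then interpret N: normal "lower_central_series G n" G .
  show ?case unfolding lower_central_series.simps
  proof (rule normal_generateI, goal_cases)
    case 1
    then show ?case using N.subset by auto
  next
    case (2 k a)
    then obtain h g where h: "h \<in> lower_central_series G n" and g: "g \<in> carrier G"
      and k: "k = h \<otimes> g \<otimes> inv h \<otimes> inv g" by auto
    let ?h = "a \<otimes> h \<otimes> inv a" and ?g = "a \<otimes> g \<otimes> inv a"
    have hc: "h \<in> carrier G" using h N.subset by auto
    have "a \<otimes> k \<otimes> inv a = ?h \<otimes> ?g \<otimes> inv ?h \<otimes> inv ?g"
      using hc g 2 k by (simp add: m_assoc inv_mult_group mult_inv_cancel)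
    moreover have "?h \<in> lower_central_series G n" using N.inv_op_closed2 2 h by simp
    ultimately show ?case using g 2 by blast
  qed
qed

lemma (in group) commutator_in_lower_central_series:
  assumes x: "x \<in> carrier G" and y: "y \<in> carrier G" and "coprime (ord x) (ord y)"
  shows "x \<otimes> y \<otimes> inv x \<otimes> inv y \<in> lower_central_series G n"
proof (induction n)
  case 0
  then show ?case using x y by simp
next
  case (Suc n)
  define N where "N = lower_central_series G (Suc n)"
  interpret N: normal N G
    unfolding N_def by (rule lower_central_series_normal)
  interpret Q: group "G Mod N" by (rule N.factorgroup_is_group)
  interpret h: group_hom G "G Mod N" "\<lambda>a. N #> a"
    by unfold_locales (rule N.r_coset_hom_Mod)
  define c where "c = x \<otimes> y \<otimes> inv x \<otimes> inv y"
  have cc: "c \<in> carrier G" using x y by (simp add: c_def)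
  \<comment> \<open>By induction \<open>c\<close> lies in the previous term, so its commutator with
    any \<open>g\<close> is among the generators of \<open>N\<close>. Hence the coset of
    \<open>c\<close> is central.\<close>
  have comm: "(N #> c) \<otimes>\<^bsub>G Mod N\<^esub> (N #> g) = (N #> g) \<otimes>\<^bsub>G Mod N\<^esub> (N #> c)"
    if g: "g \<in> carrier G" for g
  proof -
    have "c \<otimes> g \<otimes> inv c \<otimes> inv g \<in> N"
      unfolding N_def lower_central_series.simps
      using Suc g by (intro generate.incl) (auto simp: c_def)
    then have "N #> (c \<otimes> g \<otimes> inv c \<otimes> inv g) = N"
      using N.rcos_const[OF is_group] by blast
    \<comment> \<open>The product \<open>c \<otimes> g\<close> is the commutator of \<open>c\<close>
      and \<open>g\<close> times \<open>g \<otimes> c\<close>; the coset absorbs the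
      commutator.\<close>
    then have "N #> (c \<otimes> g) = N #> (c \<otimes> g \<otimes> inv c \<otimes> inv g \<otimes> (g \<otimes> c))"
      using cc g by (simp add: m_assoc mult_inv_cancel del: mult_FactGroup)
    also have "\<dots> = (N #> (c \<otimes> g \<otimes> inv c \<otimes> inv g)) #> (g \<otimes> c)"
      using cc g N.subset by (subst coset_mult_assoc) auto
    also have "\<dots> = N #> (g \<otimes> c)"
      using \<open>N #> (c \<otimes> g \<otimes> inv c \<otimes> inv g) = N\<close> by simp
    finally show ?thesis using cc g by (metis h.hom_mult)
  qed
  have "N #> c = \<one>\<^bsub>G Mod N\<^esub>"
  proof (rule Q.coprime_commutator_eq_one[where x = "N #> x" and y = "N #> y"])
    show "(N #> x) [^]\<^bsub>G Mod N\<^esub> ord x = \<one>\<^bsub>G Mod N\<^esub>"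
      using x by (metis h.hom_nat_pow h.hom_one pow_ord_eq_1)
    show "(N #> y) [^]\<^bsub>G Mod N\<^esub> ord y = \<one>\<^bsub>G Mod N\<^esub>"
      using y by (metis h.hom_nat_pow h.hom_one pow_ord_eq_1)
    show "N #> c = (N #> x) \<otimes>\<^bsub>G Mod N\<^esub> (N #> y) \<otimes>\<^bsub>G Mod N\<^esub> inv\<^bsub>G Mod N\<^esub> (N #> x)
        \<otimes>\<^bsub>G Mod N\<^esub> inv\<^bsub>G Mod N\<^esub> (N #> y)"
      unfolding c_def using x y by (simp only: h.hom_mult h.hom_inv m_closed inv_closed)
  qed (use x y comm assms(3) in \<open>simp_all only: h.hom_closed\<close>)
  then have "N #> c = N" by (simp add: FactGroup_def)
  then show ?case
    using rcos_self[OF cc N.is_subgroup] by (simp add: c_def N_def)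
qed

lemma (in group) nilpotent_coprime_ord_commute:
  assumes "nilpotent_group G" and x: "x \<in> carrier G" and y: "y \<in> carrier G"
    and "coprime (ord x) (ord y)"
  shows "x \<otimes> y = y \<otimes> x"
proof -
  obtain n where "lower_central_series G n = {\<one>}"
    using assms(1) by (auto simp: nilpotent_group_def)
  then have "x \<otimes> y \<otimes> inv x \<otimes> inv y = \<one>"
    using commutator_in_lower_central_series[OF x y assms(4), of n] by simp
  then show ?thesis
    using x y by (metis inv_closed inv_solve_right l_one m_closed)
qed

section \<open>Subgroups, Sylow subgroups and normalizers\<close>

lemma (in group) subgroup_of_subgroup_iff:
  assumes "subgroup H G"
  shows "subgroup K (G\<lparr>carrier := H\<rparr>) \<longleftrightarrow> subgroup K G \<and> K \<subseteq> H"
proof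
  assume K: "subgroup K (G\<lparr>carrier := H\<rparr>)"
  from incl_subgroup[OF assms K] subgroup.subset[OF K] show "subgroup K G \<and> K \<subseteq> H"
    by simp
next
  assume "subgroup K G \<and> K \<subseteq> H"
  then show "subgroup K (G\<lparr>carrier := H\<rparr>)"
    using subgroup_incl assms by blast
qed

lemma (in group) card_subgroup_dvd:
  assumes "subgroup H G" "subgroup K G" "K \<subseteq> H"
  shows "card K dvd card H"
proof -
  have "subgroup K (G\<lparr>carrier := H\<rparr>)"
    using assms subgroup_of_subgroup_iff by blast
  from group.lagrange[OF subgroup_imp_group[OF assms(1)] this, symmetric] show ?thesis
    by (simp add: order_def)
qed

lemma (in group) sylow_subgroup_restrict_iff:
  assumes "subgroup H G"
  shows "sylow_subgroup (G\<lparr>carrier := H\<rparr>) p Q \<longleftrightarrow>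
    Factorial_Ring.prime p \<and> subgroup Q G \<and> Q \<subseteq> H \<and> card Q = p ^ multiplicity p (card H)"
  using subgroup_of_subgroup_iff[OF assms] by (auto simp: sylow_subgroup_def order_def)

text \<open>Each given Sylow subgroup lies in \<open>H \<inter> K\<close>, so comparing
  multiplicities prime by prime shows that \<open>card H\<close> divides
  \<open>card (H \<inter> K)\<close>. Finiteness then forces
  \<open>H \<inter> K = H\<close>.\<close>

lemma (in group) subset_if_contains_sylow_subgroups:
  assumes fin: "finite (carrier G)" and H: "subgroup H G" and K: "subgroup K G"
    and sub: "\<And>p. p \<in> prime_factors (card H) \<Longrightarrow> \<exists>Q. sylow_subgroup (G\<lparr>carrier := H\<rparr>) p Q \<and> Q \<subseteq> K"
  shows "H \<subseteq> K"
proof -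
  have finH: "finite H" using fin H by (meson finite_subset subgroup.subset)
  have HK: "subgroup (H \<inter> K) G" using H K by (rule subgroups_Inter_pair)
  have pos: "card H > 0" "card (H \<inter> K) > 0"
    using finH subgroup.one_closed[OF H] subgroup.one_closed[OF HK] by (auto simp: card_gt_0_iff)
  have "card H dvd card (H \<inter> K)"
  proof (rule multiplicity_le_imp_dvd)
    fix p :: nat assume p: "Factorial_Ring.prime p"
    show "multiplicity p (card H) \<le> multiplicity p (card (H \<inter> K))"
    proof (cases "p dvd card H")
      case True
      then have "p \<in> prime_factors (card H)"
        using p pos by (auto simp: in_prime_factors_iff)
      then obtain Q where Q: "sylow_subgroup (G\<lparr>carrier := H\<rparr>) p Q" "Q \<subseteq> K"
        using sub by blast
      then have "subgroup Q G" "Q \<subseteq> H" "card Q = p ^ multiplicity p (card H)"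
        using sylow_subgroup_restrict_iff[OF H] by auto
      then have "p ^ multiplicity p (card H) dvd card (H \<inter> K)"
        using card_subgroup_dvd[OF HK] Q by (metis Int_subset_iff)
      then show ?thesis
        using p pos by (intro multiplicity_geI) (auto dest: not_prime_unit)
    qed (simp add: not_dvd_imp_multiplicity_0)
  qed (use pos in auto)
  then have "card H \<le> card (H \<inter> K)"
    using pos by (simp add: dvd_imp_le)
  then show ?thesis
    using finH card_seteq[of H "H \<inter> K"] by auto
qed

lemma (in group) ord_in_prime_power_subgroup:
  assumes p: "Factorial_Ring.prime p" and Q: "subgroup Q G" and "card Q = p ^ n" and "x \<in> Q"
  shows "\<exists>k. ord x = p ^ k"
proof -
  have x: "x \<in> carrier G" using assms subgroup.subset by blast
  have "card (generate G {x}) dvd card Q"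
    using assms x by (intro card_subgroup_dvd generate_is_subgroup generate_subgroup_incl) auto
  then show ?thesis
    using assms generate_pow_card[OF x] by (metis divides_primepow_nat)
qed

lemma (in group) sylow_subgroup_ord:
  assumes "sylow_subgroup G p P" "x \<in> P"
  shows "\<exists>k. ord x = p ^ k"
  using assms ord_in_prime_power_subgroup by (auto simp: sylow_subgroup_def)

text \<open>The order of the coset of \<open>x\<close> divides both \<open>p ^ k\<close> and the
  index of \<open>P\<close>. These are coprime, so the coset is trivial.\<close>

lemma (in group) in_normal_sylow_subgroup_if_ord:
  assumes fin: "finite (carrier G)" and P: "sylow_subgroup G p P" and "P \<lhd> G"
    and x: "x \<in> carrier G" and ordx: "ord x = p ^ k"
  shows "x \<in> P"
proof -
  interpret N: normal P G by fact
  interpret Q: group "G Mod P" by (rule N.factorgroup_is_group)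
  interpret h: group_hom G "G Mod P" "\<lambda>a. P #> a"
    by unfold_locales (rule N.r_coset_hom_Mod)
  have p: "Factorial_Ring.prime p" and cP: "card P = p ^ multiplicity p (order G)"
    using P by (auto simp: sylow_subgroup_def)
  have "order G > 0" using fin by (simp add: order_gt_0_iff_finite)
  moreover have "order (G Mod P) * card P = order G"
    using lagrange[OF N.is_subgroup] by (simp add: order_def FactGroup_def)
  \<comment> \<open>The full power of \<open>p\<close> in \<open>order G\<close> is already used up
    by \<open>card P\<close>.\<close>
  ultimately have "\<not> p dvd order (G Mod P)"
    using p cP multiplicity_decompose[of "order G" p]
    by (metis less_not_refl mult.commute nonzero_mult_div_cancel_right not_prime_unit mult_0_right)
  then have cop: "coprime (p ^ k) (order (G Mod P))"
    using p by (simp add: prime_imp_coprime)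
  have "(P #> x) [^]\<^bsub>G Mod P\<^esub> ord x = \<one>\<^bsub>G Mod P\<^esub>"
    using x by (metis h.hom_nat_pow h.hom_one pow_ord_eq_1)
  then have "group.ord (G Mod P) (P #> x) dvd p ^ k"
    using x ordx by (metis Q.pow_eq_id h.hom_closed)
  moreover have "group.ord (G Mod P) (P #> x) dvd order (G Mod P)"
    by (rule Q.ord_dvd_group_order) (use x in \<open>simp only: h.hom_closed\<close>)
  ultimately have "group.ord (G Mod P) (P #> x) = 1"
    using cop by (metis coprime_common_divisor_nat)
  then have "P #> x = P"
    using x Q.ord_eq_1[of "P #> x"] h.hom_closed by (metis monoid.select_convs(2) FactGroup_def)
  then show ?thesis
    using rcos_self[OF x N.is_subgroup] by simp
qed

text \<open>\<open>K\<close> is the normalizer of \<open>P\<close>, written elementwise. The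
  equivalence, in place of one implication, gives closure under inverses even when \<open>P\<close>
  is infinite.\<close>

lemma (in group) subgroup_conj_stabilizer:
  assumes "subgroup P G"
  defines "K \<equiv> {g \<in> carrier G. \<forall>h\<in>carrier G. h \<in> P \<longleftrightarrow> g \<otimes> h \<otimes> inv g \<in> P}"
  shows "subgroup K G"
proof (rule subgroupI)
  show "K \<subseteq> carrier G" by (auto simp: K_def)
  show "K \<noteq> {}" by (auto simp: K_def intro!: exI[of _ \<one>])
next
  fix a assume a: "a \<in> K"
  then have ac: "a \<in> carrier G" by (simp add: K_def)
  have "h \<in> P \<longleftrightarrow> inv a \<otimes> h \<otimes> inv (inv a) \<in> P" if h: "h \<in> carrier G" for h
  proof -
    \<comment> \<open>The condition on \<open>a\<close>, applied to
      \<open>inv a \<otimes> h \<otimes> a\<close>, is the condition on \<open>inv a\<close> at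
      \<open>h\<close>, read backwards.\<close>
    have "a \<otimes> (inv a \<otimes> h \<otimes> a) \<otimes> inv a = h"
      using ac h by (simp add: m_assoc mult_inv_cancel)
    then show ?thesis
      using a ac h by (force simp: K_def)
  qed
  then show "inv a \<in> K" using ac by (simp add: K_def)
next
  fix a b assume a: "a \<in> K" and b: "b \<in> K"
  then have c: "a \<in> carrier G" "b \<in> carrier G" by (simp_all add: K_def)
  have "h \<in> P \<longleftrightarrow> (a \<otimes> b) \<otimes> h \<otimes> inv (a \<otimes> b) \<in> P" if h: "h \<in> carrier G" for h
  proof -
    have "(a \<otimes> b) \<otimes> h \<otimes> inv (a \<otimes> b) = a \<otimes> (b \<otimes> h \<otimes> inv b) \<otimes> inv a"
      using c h by (simp add: m_assoc inv_mult_group)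
    moreover have "h \<in> P \<longleftrightarrow> b \<otimes> h \<otimes> inv b \<in> P"
      using b h unfolding K_def by blast
    moreover have "b \<otimes> h \<otimes> inv b \<in> P \<longleftrightarrow> a \<otimes> (b \<otimes> h \<otimes> inv b) \<otimes> inv a \<in> P"
      using a c h unfolding K_def by blast
    ultimately show ?thesis by simp
  qed
  then show "a \<otimes> b \<in> K" using c by (simp add: K_def)
qed

section \<open>Cyclic subgroups\<close>

lemma (in group) generate_mult_coprime:
  assumes x: "x \<in> carrier G" and y: "y \<in> carrier G" and xy: "x \<otimes> y = y \<otimes> x"
    and "coprime (ord x) (ord y)"
  shows "x \<in> generate G {x \<otimes> y}"
proof -
  obtain u v where "u * int (ord x) + v * int (ord y) = 1"
    using assms(4) by (metis bezout_int coprime_iff_gcd_eq_1 coprime_int_iff)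
  \<comment> \<open>The exponent \<open>v * int (ord y)\<close> is 1 modulo \<open>ord x\<close> and
    0 modulo \<open>ord y\<close>: raising \<open>x \<otimes> y\<close> to it keeps \<open>x\<close>
    and kills \<open>y\<close>.\<close>
  then have "1 - v * int (ord y) = int (ord x) * u" by (simp add: algebra_simps)
  then have "x = x [^] (v * int (ord y))"
    using x int_pow_eq[OF x, of "v * int (ord y)" 1] by simp
  moreover have "y [^] (v * int (ord y)) = \<one>"
    using int_pow_eq_id[OF y] by simp
  ultimately have "(x \<otimes> y) [^] (v * int (ord y)) = x"
    using x y xy by (simp add: int_pow_mult_distrib)
  then show ?thesis
    using generate_pow[of "x \<otimes> y"] x y by (metis (mono_tags, lifting) UNIV_I m_closed mem_Collect_eq)
qed

lemma (in group) subgroup_of_cyclic_subgroup: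
  assumes "cyclic_subgroup G C" and H: "subgroup H G" and "H \<subseteq> C" and fin: "finite (carrier G)"
  shows "cyclic_subgroup G H"
proof -
  obtain x where x: "x \<in> carrier G" and C: "C = generate G {x}"
    using assms(1) cyclic_subgroup_iff_generate by blast
  define d where "d = (LEAST d::nat. d > 0 \<and> x [^] d \<in> H)"
  \<comment> \<open>Finiteness makes \<open>ord x\<close> a positive exponent that lands in
    \<open>H\<close>, so the least one, \<open>d\<close>, exists. The power of \<open>x\<close> with
    exponent \<open>d\<close> will generate \<open>H\<close>.\<close>
  have "ord x > 0 \<and> x [^] ord x \<in> H"
    using x fin subgroup.one_closed[OF H] ord_ge_1[of x] by auto
  then have d: "d > 0" "x [^] d \<in> H"
    using LeastI[of "\<lambda>d. d > 0 \<and> x [^] d \<in> H"] by (auto simp: d_def)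
  have "h \<in> generate G {x [^] d}" if h: "h \<in> H" for h
  proof -
    obtain i :: int where i: "h = x [^] i"
      using h \<open>H \<subseteq> C\<close> C generate_pow[OF x] by auto
    \<comment> \<open>Division with remainder: the power with exponent \<open>?r\<close> also lies
      in \<open>H\<close>, and \<open>?r < d\<close> forces \<open>?r = 0\<close> by
      minimality.\<close>
    let ?r = "nat (i mod int d)"
    have eq: "x [^] i = (x [^] d) [^] (i div int d) \<otimes> x [^] ?r"
      using x d by (simp add: int_pow_pow flip: int_pow_int int_pow_mult)
    have "(x [^] d) [^] (i div int d) \<in> H"
      using subgroup_int_pow_closed[OF H d(2)] .
    then have "inv ((x [^] d) [^] (i div int d)) \<otimes> h \<in> H"
      using h H by (simp add: subgroup.m_closed subgroup.m_inv_closed)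
    also have "inv ((x [^] d) [^] (i div int d)) \<otimes> h = x [^] ?r"
      unfolding i eq using x by (simp add: inv_solve_left' m_assoc)
    finally have "x [^] ?r \<in> H" .
    moreover have "?r < d" using d by (simp add: nat_less_iff)
    ultimately have "?r = 0"
      using not_less_Least[of ?r "\<lambda>d. d > 0 \<and> x [^] d \<in> H"] by (auto simp: d_def)
    then have "h = (x [^] d) [^] (i div int d)"
      using eq i x by simp
    then show ?thesis using generate_pow[of "x [^] d"] x by auto
  qed
  then have "H = generate G {x [^] d}"
    using generate_subgroup_incl[OF _ H, of "{x [^] d}"] d by auto
  then show ?thesis using cyclic_subgroup_iff_generate x by auto
qed

lemma (in group) cyclic_subgroup_restrict_iff:
  assumes "subgroup H G"
  shows "cyclic_subgroup (G\<lparr>carrier := H\<rparr>) C \<longleftrightarrow> cyclic_subgroup G C \<and> C \<subseteq> H"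
  using subgroup_of_subgroup_iff[OF assms] by (auto simp: cyclic_subgroup_def)

lemma (in group) maximal_cyclic_subgroup_containing:
  assumes fin: "finite (carrier G)" and "cyclic_subgroup G D"
  shows "\<exists>C. maximal_cyclic_subgroup G C \<and> D \<subseteq> C"
proof -
  have "finite {C. cyclic_subgroup G C}"
    by (rule finite_subset[of _ "Pow (carrier G)"])
      (use fin in \<open>auto simp: cyclic_subgroup_def dest: subgroup.subset\<close>)
  from finite_has_maximal2[OF this, of D] assms(2) show ?thesis
    by (fastforce simp: maximal_cyclic_subgroup_def)
qed

section \<open>Independence number and maximal cyclic subgroups\<close>

lemma independence_number_enhanced_power_graph:
  fixes G (structure)
  assumes "group G" and fin: "finite (carrier G)"
  shows "independence_number (with_proj (enhanced_power_graph G)) =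
    card {C. maximal_cyclic_subgroup G C}"
proof -
  interpret group G by fact
  let ?M = "{C. maximal_cyclic_subgroup G C}"
  let ?I = "independent_set (with_proj (enhanced_power_graph G))"
  \<comment> \<open>Independence means that no cyclic subgroup contains two different elements of
    \<open>S\<close>.\<close>
  have indep: "?I S \<longleftrightarrow> S \<subseteq> carrier G \<and>
      (\<forall>x\<in>S. \<forall>y\<in>S. \<forall>C. cyclic_subgroup G C \<longrightarrow> x \<in> C \<longrightarrow> y \<in> C \<longrightarrow> x = y)" for S
    unfolding independent_set_def pairwise_def
    by (auto simp: enhanced_power_graph_def subset_iff)
  have finM: "finite ?M"
    by (rule finite_subset[of _ "Pow (carrier G)"])
      (use fin in \<open>auto simp: maximal_cyclic_subgroup_def cyclic_subgroup_def dest: subgroup.subset\<close>)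
  have "\<forall>C\<in>?M. \<exists>x\<in>carrier G. C = generate G {x}"
    using cyclic_subgroup_iff_generate by (auto simp: maximal_cyclic_subgroup_def)
  then obtain g where g: "\<And>C. C \<in> ?M \<Longrightarrow> g C \<in> carrier G \<and> C = generate G {g C}"
    by metis
  \<comment> \<open>A cyclic subgroup containing the generator of a maximal \<open>C\<close>
    contains \<open>C\<close>, hence equals it. This yields both the independence of the chosen
    generators and their distinctness.\<close>
  have gC: "C = D" if C: "C \<in> ?M" and D: "cyclic_subgroup G D" "g C \<in> D" for C D
  proof -
    have "generate G {g C} \<subseteq> D"
      using D by (intro generate_subgroup_incl) (auto simp: cyclic_subgroup_def)
    then show ?thesis
      using C D g[OF C] by (auto simp: maximal_cyclic_subgroup_def)
  qed
  have g_mem: "g C \<in> C" if "C \<in> ?M" for C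
    using g[OF that] generate.incl by (metis insertI1)
  have "?I (g ` ?M)"
    unfolding indep using g gC by blast
  moreover have "inj_on g ?M"
    by (rule inj_onI) (metis gC g_mem mem_Collect_eq maximal_cyclic_subgroup_def)
  ultimately have attained: "card ?M \<in> card ` {S. ?I S}"
    by (metis card_image image_eqI mem_Collect_eq)
  have "card S \<le> card ?M" if S: "?I S" for S
  proof -
    have "\<exists>C. C \<in> ?M \<and> x \<in> C" if "x \<in> S" for x
    proof -
      have x: "x \<in> carrier G" using S that indep by auto
      then have "cyclic_subgroup G (generate G {x})" "x \<in> generate G {x}"
        using cyclic_subgroup_iff_generate by (auto intro: generate.incl)
      then show ?thesis using maximal_cyclic_subgroup_containing[OF fin] by blast
    qed
    then obtain f where f: "\<And>x. x \<in> S \<Longrightarrow> f x \<in> ?M \<and> x \<in> f x" by metis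
    \<comment> \<open>Two elements of \<open>S\<close> with the same value of \<open>f\<close> share
      a cyclic subgroup, so independence identifies them.\<close>
    have "inj_on f S"
      by (rule inj_onI) (use S f in \<open>metis indep maximal_cyclic_subgroup_def mem_Collect_eq\<close>)
    then show ?thesis
      using f finM by (intro card_inj_on_le[of f]) auto
  qed
  moreover have "finite {S. ?I S}"
    by (rule finite_subset[of _ "Pow (carrier G)"]) (use fin in \<open>auto simp: indep\<close>)
  ultimately show ?thesis
    unfolding independence_number_def using attained by (intro Max_eqI) auto
qed

section \<open>Sylow subgroups of nilpotent groups\<close>

lemma (in group) nilpotent_sylow_normal:
  assumes nil: "nilpotent_group G" and fin: "finite (carrier G)"
    and syl: "\<And>p. p \<in> prime_factors (order G) \<Longrightarrow> sylow_subgroup G p (P p)"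
    and p: "p \<in> prime_factors (order G)"
  shows "P p \<lhd> G"
proof -
  define K where "K = {g \<in> carrier G. \<forall>h\<in>carrier G. h \<in> P p \<longleftrightarrow> g \<otimes> h \<otimes> inv g \<in> P p}"
  have sub: "subgroup (P q) G" if "q \<in> prime_factors (order G)" for q
    using syl[OF that] by (simp add: sylow_subgroup_def)
  interpret Pp: subgroup "P p" G using sub[OF p] .
  have K: "subgroup K G"
    unfolding K_def by (rule subgroup_conj_stabilizer[OF sub[OF p]])
  have "P q \<subseteq> K" if q: "q \<in> prime_factors (order G)" for q
  proof
    fix g assume g: "g \<in> P q"
    then have gc: "g \<in> carrier G" using subgroup.subset[OF sub[OF q]] by blast
    \<comment> \<open>\<open>P p\<close> is stable under conjugation by its own elements. For
      \<open>q\<close> different from \<open>p\<close>, the orders are coprime, so \<open>g\<close>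
      and \<open>h\<close> commute and conjugation fixes \<open>h\<close>.\<close>
    have conj: "g \<otimes> h \<otimes> inv g \<in> P p" if g: "g \<in> P q" and h: "h \<in> P p" for g h
    proof (cases "q = p")
      case True
      then show ?thesis using g h by simp
    next
      case False
      have gc: "g \<in> carrier G" using g subgroup.subset[OF sub[OF q]] by blast
      obtain i j where "ord g = q ^ i" "ord h = p ^ j"
        using sylow_subgroup_ord[OF syl[OF q] g] sylow_subgroup_ord[OF syl[OF p] h] by auto
      moreover have "coprime q p"
        using False p q by (auto intro!: primes_coprime simp: in_prime_factors_iff)
      ultimately have "coprime (ord g) (ord h)" by simp
      from nilpotent_coprime_ord_commute[OF nil gc Pp.mem_carrier[OF h] this]
      have "g \<otimes> h \<otimes> inv g = h"
        using inv_solve_right[of h "g \<otimes> h" g] gc Pp.mem_carrier[OF h] by simp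
      then show ?thesis using h by simp
    qed
    \<comment> \<open>The converse follows by conjugating back with \<open>inv g\<close>, again an
      element of \<open>P q\<close>.\<close>
    have "h \<in> P p" if h: "h \<in> carrier G" "g \<otimes> h \<otimes> inv g \<in> P p" for h
    proof -
      have "inv g \<in> P q" using g sub[OF q] by (simp add: subgroup.m_inv_closed)
      from conj[OF this h(2)] show ?thesis
        using gc h(1) by (simp add: m_assoc mult_inv_cancel)
    qed
    then have "h \<in> P p \<longleftrightarrow> g \<otimes> h \<otimes> inv g \<in> P p" if "h \<in> carrier G" for h
      using conj[OF g, of h] that by (intro iffI)
    then show "g \<in> K" unfolding K_def using gc by blast
  qed
  then have "\<exists>Q. sylow_subgroup (G\<lparr>carrier := carrier G\<rparr>) q Q \<and> Q \<subseteq> K"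
    if "q \<in> prime_factors (card (carrier G))" for q
    using syl[of q] that by (intro exI[of _ "P q"]) (simp add: order_def)
  then have "carrier G \<subseteq> K"
    by (rule subset_if_contains_sylow_subgroups[OF fin subgroup_self K])
  then have "g \<otimes> h \<otimes> inv g \<in> P p" if "g \<in> carrier G" "h \<in> P p" for g h
    using that Pp.subset unfolding K_def by blast
  then show ?thesis
    using sub[OF p] by (intro normal_invI)
qed

text \<open>A Sylow \<open>p\<close>-subgroup of \<open>H\<close> consists of elements of
  \<open>p\<close>-power order. Normality of \<open>P p\<close> puts them all in \<open>P p\<close>,
  hence in \<open>H \<inter> P p\<close> and so in \<open>K\<close>.\<close>

lemma (in group) nilpotent_subset_if_inter_sylow_subset:
  assumes nil: "nilpotent_group G" and fin: "finite (carrier G)"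
    and syl: "\<And>p. p \<in> prime_factors (order G) \<Longrightarrow> sylow_subgroup G p (P p)"
    and H: "subgroup H G" and K: "subgroup K G"
    and sub: "\<And>p. p \<in> prime_factors (order G) \<Longrightarrow> H \<inter> P p \<subseteq> K"
  shows "H \<subseteq> K"
proof (rule subset_if_contains_sylow_subgroups[OF fin H K])
  fix p assume p: "p \<in> prime_factors (card H)"
  have "card H dvd order G"
    using card_subgroup_dvd[OF subgroup_self H subgroup.subset[OF H]] by (simp add: order_def)
  then have pG: "p \<in> prime_factors (order G)"
    using p fin by (auto simp: in_prime_factors_iff order_gt_0_iff_finite)
  obtain Q where Q: "sylow_subgroup (G\<lparr>carrier := H\<rparr>) p Q"
    using sylow_subgroup_exists[OF subgroup_imp_group[OF H], of p] p fin subgroup.subset[OF H]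
    by (auto simp: in_prime_factors_iff intro: finite_subset)
  have "x \<in> P p" if x: "x \<in> Q" for x
  proof -
    have QG: "Factorial_Ring.prime p" "subgroup Q G" "Q \<subseteq> H" "card Q = p ^ multiplicity p (card H)"
      using Q sylow_subgroup_restrict_iff[OF H] by auto
    then have xc: "x \<in> carrier G" using x subgroup.subset by blast
    obtain k where "ord x = p ^ k"
      using ord_in_prime_power_subgroup[OF QG(1,2,4) x] by blast
    then show ?thesis
      using in_normal_sylow_subgroup_if_ord[OF fin syl[OF pG]] nilpotent_sylow_normal[OF nil fin syl pG] xc
      by blast
  qed
  then have "Q \<subseteq> K"
    using sub[OF pG] Q sylow_subgroup_restrict_iff[OF H] by blast
  then show "\<exists>Q. sylow_subgroup (G\<lparr>carrier := H\<rparr>) p Q \<and> Q \<subseteq> K" using Q by blast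
qed

text \<open>Induction over \<open>A\<close>, multiplying \<open>z\<close> by the new
  \<open>x p\<close>; coprime orders make the factors commute and both recoverable as powers of the
  product. The last two conjuncts carry the induction: they ensure that \<open>p\<close> does not
  divide \<open>ord z\<close>. Positivity excludes infinite order, encoded as 0, whose set of prime
  factors is empty.\<close>

lemma (in group) nilpotent_generator_of_primary_elements:
  assumes nil: "nilpotent_group G" and "finite A"
    and "\<And>p. p \<in> A \<Longrightarrow> Factorial_Ring.prime p \<and> x p \<in> carrier G \<and> (\<exists>k. ord (x p) = p ^ k)"
  shows "\<exists>z\<in>carrier G. (\<forall>p\<in>A. x p \<in> generate G {z}) \<and> prime_factors (ord z) \<subseteq> A \<and> ord z > 0"
  using assms(2,3)
proof (induction A)
  case empty
  then show ?case by (intro bexI[of _ \<one>]) auto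
next
  case (insert p A)
  then obtain z where z: "z \<in> carrier G" "\<forall>q\<in>A. x q \<in> generate G {z}"
    "prime_factors (ord z) \<subseteq> A" "ord z > 0" by auto
  obtain k where p: "Factorial_Ring.prime p" and xc: "x p \<in> carrier G" and k: "ord (x p) = p ^ k"
    using insert.prems by blast
  have "\<not> p dvd ord z"
    using z insert.hyps p by (auto simp: in_prime_factors_iff)
  then have cop: "coprime (ord z) (ord (x p))"
    using p k by (simp add: prime_imp_coprime coprime_commute)
  then have comm: "z \<otimes> x p = x p \<otimes> z"
    using nilpotent_coprime_ord_commute[OF nil z(1) xc] by simp
  let ?w = "z \<otimes> x p"
  have w: "?w \<in> carrier G" using z xc by simp
  have zw: "z \<in> generate G {?w}"
    using generate_mult_coprime[OF z(1) xc comm cop] .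
  have xw: "x p \<in> generate G {?w}"
    using generate_mult_coprime[OF xc z(1) comm[symmetric]] cop comm by (simp add: coprime_commute)
  have "generate G {z} \<subseteq> generate G {?w}"
    using zw w by (intro generate_subgroup_incl generate_is_subgroup) auto
  then have gen: "\<forall>q\<in>insert p A. x q \<in> generate G {?w}"
    using z(2) xw by auto
  have dvd: "ord ?w dvd ord z * ord (x p)"
    using ord_mul_divides[OF comm z(1) xc] .
  have pos: "ord z * ord (x p) > 0" using z(4) k p by (simp add: prime_gt_0_nat)
  have "prime_factors (ord ?w) \<subseteq> prime_factors (ord z * ord (x p))"
    using dvd pos by (intro dvd_prime_factors) auto
  also have "\<dots> \<subseteq> insert p A"
  proof
    fix q assume "q \<in> prime_factors (ord z * ord (x p))"
    then have q: "Factorial_Ring.prime q" "q dvd ord z \<or> q dvd p ^ k"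
      by (auto simp: in_prime_factors_iff prime_dvd_mult_iff k)
    from q(2) show "q \<in> insert p A"
    proof
      assume "q dvd ord z"
      then show ?thesis using q(1) z(3,4) by (auto simp: in_prime_factors_iff)
    next
      assume "q dvd p ^ k"
      then have "q = p" using q(1) p by (metis prime_dvd_power primes_dvd_imp_eq)
      then show ?thesis by simp
    qed
  qed
  finally show ?case
    using gen w dvd pos by (intro bexI[of _ ?w]) (auto intro: Nat.gr0I)
qed

text \<open>Serves the bijection below twice: to enlarge one Sylow component of a cyclic subgroup
  while keeping the others, and to assemble a cyclic subgroup from a given family.\<close>

lemma (in group) nilpotent_cyclic_subgroup_containing:
  assumes nil: "nilpotent_group G"
    and syl: "\<And>p. p \<in> prime_factors (order G) \<Longrightarrow> sylow_subgroup G p (P p)"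
    and C: "\<And>p. p \<in> prime_factors (order G) \<Longrightarrow> cyclic_subgroup G (C p) \<and> C p \<subseteq> P p"
  shows "\<exists>E. cyclic_subgroup G E \<and> (\<forall>p\<in>prime_factors (order G). C p \<subseteq> E)"
proof -
  have "\<forall>p\<in>prime_factors (order G). \<exists>x\<in>carrier G. C p = generate G {x}"
    using C cyclic_subgroup_iff_generate by blast
  then obtain x where x: "\<And>p. p \<in> prime_factors (order G) \<Longrightarrow> x p \<in> carrier G \<and> C p = generate G {x p}"
    by metis
  have xP: "x p \<in> P p" if "p \<in> prime_factors (order G)" for p
    using x[OF that] C[OF that] generate.incl[of "x p" "{x p}" G] by auto
  obtain z where z: "z \<in> carrier G" "\<forall>p\<in>prime_factors (order G). x p \<in> generate G {z}"
    using nilpotent_generator_of_primary_elements[OF nil, of "prime_factors (order G)" x]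
      x xP sylow_subgroup_ord[OF syl] by (auto simp: in_prime_factors_iff)
  have "C p \<subseteq> generate G {z}" if "p \<in> prime_factors (order G)" for p
  proof -
    have "generate G {x p} \<subseteq> generate G {z}"
      using z that by (intro generate_subgroup_incl generate_is_subgroup) simp_all
    then show ?thesis using x[OF that] by simp
  qed
  then show ?thesis
    using z cyclic_subgroup_iff_generate by blast
qed

section \<open>Maximal cyclic subgroups as families of Sylow components\<close>

lemma (in group) nilpotent_bij_betw_maximal_cyclic_subgroups:
  assumes nil: "nilpotent_group G" and fin: "finite (carrier G)"
    and syl: "\<And>p. p \<in> prime_factors (order G) \<Longrightarrow> sylow_subgroup G p (P p)"
  shows "bij_betw (\<lambda>C. \<lambda>p\<in>prime_factors (order G). C \<inter> P p)
    {C. maximal_cyclic_subgroup G C}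
    (\<Pi>\<^sub>E p\<in>prime_factors (order G). {C. maximal_cyclic_subgroup (G\<lparr>carrier := P p\<rparr>) C})"
    (is "bij_betw ?f ?M (PiE ?A ?N)")
proof -
  have sub: "subgroup (P p) G" if "p \<in> ?A" for p
    using syl[OF that] by (simp add: sylow_subgroup_def)
  have cyc: "cyclic_subgroup G (C \<inter> P p)" if "cyclic_subgroup G C" "p \<in> ?A" for C p
    using that subgroup_of_cyclic_subgroup[OF that(1) _ _ fin] sub subgroups_Inter_pair
    by (simp add: cyclic_subgroup_def)
  have N: "D \<in> ?N p \<longleftrightarrow> cyclic_subgroup G D \<and> D \<subseteq> P p \<and>
      (\<forall>E. cyclic_subgroup G E \<longrightarrow> E \<subseteq> P p \<longrightarrow> D \<subseteq> E \<longrightarrow> D = E)" if "p \<in> ?A" for D p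
    using cyclic_subgroup_restrict_iff[OF sub[OF that]]
    by (auto simp: maximal_cyclic_subgroup_def)
  have M: "C \<in> ?M \<longleftrightarrow> cyclic_subgroup G C \<and> (\<forall>E. cyclic_subgroup G E \<longrightarrow> C \<subseteq> E \<longrightarrow> C = E)" for C
    by (auto simp: maximal_cyclic_subgroup_def)
  have le: "C \<subseteq> D" if "cyclic_subgroup G C" "cyclic_subgroup G D" "\<And>p. p \<in> ?A \<Longrightarrow> C \<inter> P p \<subseteq> D" for C D
    using nilpotent_subset_if_inter_sylow_subset[OF nil fin syl, of C D] that
    by (simp add: cyclic_subgroup_def)
  have "inj_on ?f ?M"
  proof (rule inj_onI)
    fix C D assume C: "C \<in> ?M" and D: "D \<in> ?M" and eq: "?f C = ?f D"
    have "C \<inter> P p = D \<inter> P p" if "p \<in> ?A" for p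
      using fun_cong[OF eq, of p] that by simp
    then have "C \<subseteq> D" using C D unfolding M by (metis le inf_le1)
    then show "C = D" using C D M by blast
  qed
  moreover have "?f C \<in> PiE ?A ?N" if C: "C \<in> ?M" for C
  proof -
    have cC: "cyclic_subgroup G C" using C M by blast
    have "C \<inter> P q = D" if q: "q \<in> ?A" and D: "cyclic_subgroup G D" "D \<subseteq> P q" "C \<inter> P q \<subseteq> D" for q D
    proof -
      \<comment> \<open>Replace the \<open>q\<close>-component of \<open>C\<close> by the larger
        \<open>D\<close>. A cyclic \<open>E\<close> containing all components contains
        \<open>C\<close>, so \<open>E = C\<close> by maximality, and \<open>D\<close> lies in
        \<open>C \<inter> P q\<close>.\<close>
      define B where "B p = (if p = q then D else C \<inter> P p)" for p
      have "\<exists>E. cyclic_subgroup G E \<and> (\<forall>p\<in>?A. B p \<subseteq> E)"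
        using cyc[OF cC] D by (intro nilpotent_cyclic_subgroup_containing[OF nil syl]) (auto simp: B_def)
      then obtain E where E: "cyclic_subgroup G E" "\<And>p. p \<in> ?A \<Longrightarrow> B p \<subseteq> E" by blast
      have "C \<inter> P p \<subseteq> E" if "p \<in> ?A" for p
        using E(2)[OF that] D by (auto simp: B_def split: if_splits)
      then have "C = E" using le[OF cC E(1)] C M E(1) by blast
      then show ?thesis using E(2)[OF q] D by (auto simp: B_def)
    qed
    then show ?thesis using N cyc[OF cC] by (auto simp: PiE_iff)
  qed
  moreover have "B \<in> ?f ` ?M" if B: "B \<in> PiE ?A ?N" for B
  proof -
    have BN: "B p \<in> ?N p" if "p \<in> ?A" for p using B that by (rule PiE_mem)
    have "\<exists>E. cyclic_subgroup G E \<and> (\<forall>p\<in>?A. B p \<subseteq> E)"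
      using BN N by (intro nilpotent_cyclic_subgroup_containing[OF nil syl]) blast+
    then obtain E where E: "cyclic_subgroup G E" "\<And>p. p \<in> ?A \<Longrightarrow> B p \<subseteq> E" by blast
    \<comment> \<open>For cyclic \<open>F\<close> above \<open>E\<close>, the intersection is a
      cyclic subgroup of \<open>P p\<close> containing the maximal \<open>B p\<close>. The case
      \<open>F = E\<close> computes the image of \<open>E\<close>; larger \<open>F\<close> serve to
      show that \<open>E\<close> is maximal.\<close>
    have inter: "F \<inter> P p = B p" if "cyclic_subgroup G F" "E \<subseteq> F" "p \<in> ?A" for F p
    proof -
      have B: "B p \<subseteq> P p" "\<And>D. cyclic_subgroup G D \<Longrightarrow> D \<subseteq> P p \<Longrightarrow> B p \<subseteq> D \<Longrightarrow> B p = D"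
        using BN[OF that(3)] unfolding N[OF that(3)] by simp_all
      have "B p \<subseteq> F \<inter> P p"
        using B(1) E(2)[OF that(3)] that(2) by blast
      from B(2)[OF cyc[OF that(1,3)] _ this] show ?thesis by simp
    qed
    have "E = F" if F: "cyclic_subgroup G F" "E \<subseteq> F" for F
    proof -
      have "F \<inter> P p \<subseteq> E" if "p \<in> ?A" for p
        using inter[OF F that] E(2)[OF that] by simp
      then show ?thesis using le[OF F(1) E(1)] F(2) by blast
    qed
    then have "E \<in> ?M" using E M by blast
    \<comment> \<open>Both functions are extensional on \<open>?A\<close>, so agreement at each
      prime suffices.\<close>
    moreover have "?f E = B"
      using inter[OF E(1) subset_refl] B by (intro extensionalityI[of _ ?A]) (auto simp: PiE_iff)
    ultimately show ?thesis by blast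
  qed
  ultimately show ?thesis
    unfolding bij_betw_def by blast
qed

theorem theorem3p3:
  fixes G :: "('a, 'b) monoid_scheme"
  assumes "group G" and "finite (carrier G)"
  shows "independence_number (with_proj (enhanced_power_graph G)) =
           card {C. maximal_cyclic_subgroup G C} \<and>
         (nilpotent_group G \<longrightarrow>
           (\<forall>P. (\<forall>p\<in>prime_factors (order G). sylow_subgroup G p (P p)) \<longrightarrow>
             independence_number (with_proj (enhanced_power_graph G)) =
               (\<Prod>p\<in>prime_factors (order G).
                  card {C. maximal_cyclic_subgroup (G\<lparr>carrier := P p\<rparr>) C})))"
  \<comment> \<open>The bijection replaces the count of maximal cyclic subgroups by the count of
    families, which \<open>card_PiE\<close> turns into the product.\<close>
  using independence_number_enhanced_power_graph[OF assms]
    group.nilpotent_bij_betw_maximal_cyclic_subgroups[OF assms(1) _ assms(2), THEN bij_betw_same_card]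
  by (simp add: card_PiE)

end
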